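(* The following connection formulas for the CMV biorthogonal Laurent polynomials hold, for $z\in\mathbb C^*$: $$\Omega^{(1,2)}_1\tilde\phi^{(1,2)}_1(z)=L^{(1)}_\Gamma(z)\phi_1(z),\qquad \Omega^{(1,2)}_2\phi_2(z)=L^{(2)}_{\mathfrak C}(z)\tilde\phi^{(1,2)}_2(z),$$ $$\Omega^{(2,1)}_1\phi_1(z)=L^{(1)}_{\mathfrak C}(z)\tilde\phi^{(2,1)}_1(z),\qquad \Omega^{(2,1)}_2\tilde\phi^{(2,1)}_2(z)=L^{(2)}_\Gamma(z)\phi_2(z).$$
   Context: Conventions: $\mathbb C^*=\mathbb C\setminus\{0\}$; $\dagger$ is conjugate transpose; $\sigma(L)$ is the zero set of $L$ in $\mathbb C^*$; $f^{(l)}=\partial^lf/\partial z^l$. Functionals: $\mathcal F$ is a space of fundamental (test) functions on $\mathbb C^*$ strictly containing $\mathbb C[z,z^{-1}]$, whose continuous linear functionals have a well-defined support (e.g. $\mathcal F=C^\infty(\mathbb C^* )$, functionals being compactly supported distributions). A functional may be evaluated on functions admissible only on a neighbourhood of its support. $u=u_{z_1,\bar z_2}$ is a bivariate linear functional with well-defined support; $\operatorname{supp}_1(u),\operatorname{supp}_2(u)$ are the projections of the support to the $z_1$- and $z_2$-coordinates. Its sesquilinear form is $\langle f(z_1),g(z_2)\rangle_u=\langle u_{z_1,\bar z_2},f(z_1)\otimes\overline{g(z_2)}\rangle$. CMV basis: $\chi=[\chi^{(0)},\chi^{(1)},\dots]^\top$, $\chi^{(2k)}(z)=z^k$, $\chi^{(2k+1)}(z)=z^{-k-1}$.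 $\Upsilon$ is the semi-infinite $0/1$ matrix with nonzero entries $\Upsilon_{2k,2k+2}=1$ ($k\ge0$), $\Upsilon_{1,0}=1$, $\Upsilon_{2k+1,2k-1}=1$ ($k\ge1$); it satisfies $\Upsilon\chi(z)=z\chi(z)$, $\Upsilon^{-1}=\Upsilon^\top$; for $L(z)=\sum_kL_kz^k$, $L(\Upsilon)=\sum_kL_k\Upsilon^k$. Gram matrix $G=(\langle\chi^{(k)},\chi^{(l)}\rangle_u)_{k,l\ge0}$, assumed quasidefinite (all leading principal minors nonzero), so $G=S_1^{-1}H(S_2^{-1})^\dagger$ with $S_1,S_2$ lower unitriangular and $H=\operatorname{diag}(H_0,H_1,\dots)$ nonsingular. $\phi_1=S_1\chi$, $\phi_2=S_2\chi$. Geronimus–Uvarov perturbations: for $a\in\{1,2\}$, $L^{(a)}_\rho(z)=L^{(a)}_{\rho,N^+_\rho}z^{N^+_\rho}+\dots+L^{(a)}_{\rho,-N^-_\rho}z^{-N^-_\rho}$, $\rho\in\{\Gamma,\mathfrak C\}$, $N^\pm_\rho\in\{1,2,\dots\}$, with nonzero extreme coefficients, $\sigma(L^{(1)}_\Gamma)\cap\operatorname{supp}_1(u)=\varnothing$, $\sigma(L^{(2)}_\Gamma)\cap\operatorname{supp}_2(u)=\varnothing$. $L^{(a)}_\Gamma$ has distinct zeros $\zeta^{(a)}_i$ with multiplicities $m^{(a)}_i$, $1\le i\le d^{(a)}$; $\xi^{(a)}_{i,l}$ are arbitrary univariate linear functionals. The perturbed forms are $$\langle f,g\rangle_{\tilde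 u^{(1,2)}}=\Big\langle u,\tfrac{f(z_1)}{L^{(1)}_\Gamma(z_1)}\otimes\overline{L^{(2)}_{\mathfrak C}(z_2)g(z_2)}\Big\rangle+\sum_{i=1}^{d^{(1)}}\sum_{l=0}^{m^{(1)}_i-1}\tfrac1{l!}f^{(l)}(\zeta^{(1)}_i)\overline{\langle\xi^{(1)}_{i,l},L^{(2)}_{\mathfrak C}g\rangle},$$ $$\langle f,g\rangle_{\tilde u^{(2,1)}}=\Big\langle u,L^{(1)}_{\mathfrak C}(z_1)f(z_1)\otimes\overline{\tfrac{g(z_2)}{L^{(2)}_\Gamma(z_2)}}\Big\rangle+\sum_{i=1}^{d^{(2)}}\sum_{l=0}^{m^{(2)}_i-1}\tfrac1{l!}\langle\xi^{(2)}_{i,l},L^{(1)}_{\mathfrak C}f\rangle\overline{g^{(l)}(\zeta^{(2)}_i)}.$$ Their Gram matrices $\tilde G^{(1)}$ (of $\tilde u^{(1,2)}$) and $\tilde G^{(2)}$ (of $\tilde u^{(2,1)}$) in the CMV basis are assumed quasidefinite: $\tilde G^{(1)}=(\tilde S^{(1)}_1)^{-1}\tilde H^{(1,2)}(\tilde S^{(1)}_2)^{-\dagger}$, $\tilde G^{(2)}=(\tilde S^{(2)}_1)^{-1}\tilde H^{(2,1)}(\tilde S^{(2)}_2)^{-\dagger}$ (lower unitriangular $\tilde S$'s, diagonal nonsingular $\tilde H$'s); $\tilde\phi^{(1,2)}_j=\tilde S^{(1)}_j\chi$, $\tilde\phi^{(2,1)}_j=\tilde S^{(2)}_j\chi$,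 $j=1,2$. Connectors: $\Omega^{(1,2)}_1=S_1L^{(1)}_\Gamma(\Upsilon)(\tilde S^{(1)}_1)^{-1}$, $\Omega^{(1,2)}_2=\tilde S^{(1)}_2L^{(2)}_{\mathfrak C}(\Upsilon)S_2^{-1}$, $\Omega^{(2,1)}_1=\tilde S^{(2)}_1L^{(1)}_{\mathfrak C}(\Upsilon)S_1^{-1}$, $\Omega^{(2,1)}_2=S_2L^{(2)}_\Gamma(\Upsilon)(\tilde S^{(2)}_2)^{-1}$. *)

theory Defs
  imports
    "HOL-Complex_Analysis.Complex_Analysis"
    "HOL-Library.Poly_Mapping"
    "HOL-Library.Groups_Big_Fun"
    "Jordan_Normal_Form.Determinant"
begin

section \<open>Laurent polynomials\<close>

text \<open>Laurent polynomials are elements of the group algebra of the integers over the complex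
  numbers, that is, finitely supported families of coefficients.\<close>

type_synonym laurent = "int \<Rightarrow>\<^sub>0 complex"

definition laurent_eval :: "laurent \<Rightarrow> complex \<Rightarrow> complex" where
  "laurent_eval p z = (\<Sum>k\<in>Poly_Mapping.keys p. Poly_Mapping.lookup p k * z powi k)"

definition laurent_zeros :: "laurent \<Rightarrow> complex set" where
  "laurent_zeros p = {z. z \<noteq> 0 \<and> laurent_eval p z = 0}"

definition laurent_bidegree :: "laurent \<Rightarrow> nat \<Rightarrow> nat \<Rightarrow> bool" where
  "laurent_bidegree p Np Nm \<longleftrightarrow>
     1 \<le> Np \<and> 1 \<le> Nm \<and>
     Poly_Mapping.keys p \<subseteq> {- int Nm..int Np} \<and>
     Poly_Mapping.lookup p (int Np) \<noteq> 0 \<and> Poly_Mapping.lookup p (- int Nm) \<noteq> 0"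

definition zeros_with_mult ::
    "laurent \<Rightarrow> nat \<Rightarrow> (nat \<Rightarrow> complex) \<Rightarrow> (nat \<Rightarrow> nat) \<Rightarrow> bool" where
  "zeros_with_mult p d \<zeta> m \<longleftrightarrow>
     bij_betw \<zeta> {1..d} (laurent_zeros p) \<and>
     (\<forall>i\<in>{1..d}. zorder (laurent_eval p) (\<zeta> i) = int (m i))"


section \<open>Spaces of test functions and supports of functionals\<close>

text \<open>A function on an open set \<open>X\<close> is represented by its extension by \<open>0\<close> to the whole
  type. Below, \<open>X\<close> is the punctured plane or its square.\<close>

definition cstar :: "complex set" where
  "cstar = - {0}"

definition on_cstar :: "(complex \<Rightarrow> complex) \<Rightarrow> complex \<Rightarrow> complex" where
  "on_cstar f z = (if z = 0 then 0 else f z)"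

definition function_space :: "'a set \<Rightarrow> ('a \<Rightarrow> complex) set \<Rightarrow> bool" where
  "function_space X F \<longleftrightarrow>
     (\<forall>f\<in>F. \<forall>x. x \<notin> X \<longrightarrow> f x = 0) \<and>
     (\<lambda>x. 0) \<in> F \<and>
     (\<forall>f\<in>F. \<forall>g\<in>F. (\<lambda>x. f x + g x) \<in> F) \<and>
     (\<forall>c. \<forall>f\<in>F. (\<lambda>x. c * f x) \<in> F)"

definition linear_functional ::
    "('a \<Rightarrow> complex) set \<Rightarrow> (('a \<Rightarrow> complex) \<Rightarrow> complex) \<Rightarrow> bool" where
  "linear_functional F w \<longleftrightarrow>
     (\<forall>f\<in>F. \<forall>g\<in>F. w (\<lambda>x. f x + g x) = w f + w g) \<and>
     (\<forall>c. \<forall>f\<in>F. w (\<lambda>x. c * f x) = c * w f)"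

definition null_on :: "'a::topological_space set \<Rightarrow> ('a \<Rightarrow> complex) set \<Rightarrow>
    (('a \<Rightarrow> complex) \<Rightarrow> complex) \<Rightarrow> 'a set \<Rightarrow> bool" where
  "null_on X F w U \<longleftrightarrow> (\<forall>f\<in>F. X \<inter> closure {x. f x \<noteq> 0} \<subseteq> U \<longrightarrow> w f = 0)"

definition null_region :: "'a::topological_space set \<Rightarrow> ('a \<Rightarrow> complex) set \<Rightarrow>
    (('a \<Rightarrow> complex) \<Rightarrow> complex) \<Rightarrow> 'a set" where
  "null_region X F w = \<Union>{U. open U \<and> U \<subseteq> X \<and> null_on X F w U}"

definition supp :: "'a::topological_space set \<Rightarrow> ('a \<Rightarrow> complex) set \<Rightarrow>
    (('a \<Rightarrow> complex) \<Rightarrow> complex) \<Rightarrow> 'a set" where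
  "supp X F w = X - null_region X F w"

text \<open>The support is well defined when there is a largest open set on which the functional
  vanishes. The closures are taken relative to \<open>X\<close>.\<close>

definition has_support :: "'a::topological_space set \<Rightarrow> ('a \<Rightarrow> complex) set \<Rightarrow>
    (('a \<Rightarrow> complex) \<Rightarrow> complex) \<Rightarrow> bool" where
  "has_support X F w \<longleftrightarrow> null_on X F w (null_region X F w)"

definition fundamental_space ::
    "(complex \<Rightarrow> complex) set \<Rightarrow> (complex \<Rightarrow> complex) topology \<Rightarrow> bool" where
  "fundamental_space F T \<longleftrightarrow>
     function_space cstar F \<and>
     range (\<lambda>p. on_cstar (laurent_eval p)) \<subset> F \<and>
     topspace T = F \<and>
     continuous_map (prod_topology T T) T (\<lambda>(f, g). \<lambda>x. f x + g x) \<and>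
     continuous_map (prod_topology euclidean T) T (\<lambda>(c, f). \<lambda>x. c * f x) \<and>
     (\<forall>w. linear_functional F w \<and> continuous_map T euclidean w \<longrightarrow> has_support cstar F w)"

text \<open>A functional \<open>w\<close> is evaluated on a function \<open>h\<close> that is only admissible near the support
  of \<open>w\<close> by evaluating it on any test function that agrees with \<open>h\<close> near the support; the
  lemma \<open>pairing_eq\<close> says that the choice does not matter.\<close>

definition agrees_near_supp :: "'a::topological_space set \<Rightarrow> ('a \<Rightarrow> complex) set \<Rightarrow>
    (('a \<Rightarrow> complex) \<Rightarrow> complex) \<Rightarrow> ('a \<Rightarrow> complex) \<Rightarrow> ('a \<Rightarrow> complex) \<Rightarrow> bool" where
  "agrees_near_supp X F w f h \<longleftrightarrow>
     (\<exists>V. open V \<and> V \<subseteq> X \<and> supp X F w \<subseteq> V \<and> (\<forall>x\<in>V. f x = h x))"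

definition admissible :: "'a::topological_space set \<Rightarrow> ('a \<Rightarrow> complex) set \<Rightarrow>
    (('a \<Rightarrow> complex) \<Rightarrow> complex) \<Rightarrow> ('a \<Rightarrow> complex) \<Rightarrow> bool" where
  "admissible X F w h \<longleftrightarrow> (\<exists>f\<in>F. agrees_near_supp X F w f h)"

definition pairing :: "'a::topological_space set \<Rightarrow> ('a \<Rightarrow> complex) set \<Rightarrow>
    (('a \<Rightarrow> complex) \<Rightarrow> complex) \<Rightarrow> ('a \<Rightarrow> complex) \<Rightarrow> complex" where
  "pairing X F w h = (THE c. \<exists>f\<in>F. agrees_near_supp X F w f h \<and> c = w f)"

lemma pairing_eq:
  assumes F: "function_space X F" and w: "linear_functional F w" and s: "has_support X F w"
    and f: "f \<in> F" "agrees_near_supp X F w f h"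
  shows "pairing X F w h = w f"
  unfolding pairing_def
proof (rule the_equality)
  fix c assume "\<exists>g\<in>F. agrees_near_supp X F w g h \<and> c = w g"
  then obtain g where g: "g \<in> F" "agrees_near_supp X F w g h" "c = w g" by blast
  obtain V where V: "open V" "supp X F w \<subseteq> V" "\<forall>x\<in>V. f x = h x"
    using f(2) unfolding agrees_near_supp_def by blast
  obtain W where W: "open W" "supp X F w \<subseteq> W" "\<forall>x\<in>W. g x = h x"
    using g(2) unfolding agrees_near_supp_def by blast
  define k where "k = (\<lambda>x. g x + (-1) * f x)"
  have m: "(\<lambda>x. (-1) * f x) \<in> F" using F f(1) unfolding function_space_def by blast
  have "\<And>a b. a \<in> F \<Longrightarrow> b \<in> F \<Longrightarrow> (\<lambda>x. a x + b x) \<in> F"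
    using F unfolding function_space_def by blast
  from this[OF g(1) m] have kF: "k \<in> F" unfolding k_def .
  have "{x. k x \<noteq> 0} \<subseteq> - (V \<inter> W)" using V W by (auto simp: k_def)
  then have "closure {x. k x \<noteq> 0} \<subseteq> - (V \<inter> W)"
    using V(1) W(1) by (intro closure_minimal) auto
  then have "X \<inter> closure {x. k x \<noteq> 0} \<subseteq> null_region X F w"
    using V(2) W(2) unfolding supp_def by blast
  then have "w k = 0" using s kF unfolding has_support_def null_on_def by blast
  moreover have "\<And>a b. a \<in> F \<Longrightarrow> b \<in> F \<Longrightarrow> w (\<lambda>x. a x + b x) = w a + w b"
    using w unfolding linear_functional_def by blast
  from this[OF g(1) m] have "w k = w g + w (\<lambda>x. (-1) * f x)" unfolding k_def .
  moreover have "w (\<lambda>x. (-1) * f x) = (-1) * w f"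
    using w f(1) unfolding linear_functional_def by blast
  ultimately show "c = w f" using g(3) by simp
qed (use f in blast)


section \<open>Bivariate functionals and their sesquilinear forms\<close>

definition cstar2 :: "(complex \<times> complex) set" where
  "cstar2 = cstar \<times> cstar"

definition tensor_cnj ::
    "(complex \<Rightarrow> complex) \<Rightarrow> (complex \<Rightarrow> complex) \<Rightarrow> complex \<times> complex \<Rightarrow> complex" where
  "tensor_cnj f g = (\<lambda>(z1, z2). f z1 * cnj (g z2))"

definition supp1 ::
    "(complex \<times> complex \<Rightarrow> complex) set \<Rightarrow> ((complex \<times> complex \<Rightarrow> complex) \<Rightarrow> complex) \<Rightarrow> complex set"
  where "supp1 E u = fst ` supp cstar2 E u"

definition supp2 ::
    "(complex \<times> complex \<Rightarrow> complex) set \<Rightarrow> ((complex \<times> complex \<Rightarrow> complex) \<Rightarrow> complex) \<Rightarrow> complex set"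
  where "supp2 E u = snd ` supp cstar2 E u"

text \<open>\<open>E\<close> is the space of bivariate test functions on which \<open>u\<close> acts. The last condition
  says that quotients of Laurent polynomials without poles in the projections of the support
  are admissible near the support. It holds, for instance, for compactly supported
  distributions, by multiplication with a cut-off function.\<close>

definition bivariate_functional :: "(complex \<Rightarrow> complex) set \<Rightarrow>
    (complex \<times> complex \<Rightarrow> complex) set \<Rightarrow>
    ((complex \<times> complex \<Rightarrow> complex) \<Rightarrow> complex) \<Rightarrow> bool" where
  "bivariate_functional F E u \<longleftrightarrow>
     function_space cstar2 E \<and>
     (\<forall>f\<in>F. \<forall>g\<in>F. tensor_cnj f g \<in> E) \<and>
     linear_functional E u \<and>
     has_support cstar2 E u \<and>
     (\<forall>f g p q. laurent_zeros p \<inter> supp1 E u = {} \<and> laurent_zeros q \<inter> supp2 E u = {} \<longrightarrow>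
        admissible cstar2 E u
          (tensor_cnj (\<lambda>z. laurent_eval f z / laurent_eval p z)
                      (\<lambda>z. laurent_eval g z / laurent_eval q z)))"

definition sesq_form ::
    "(complex \<times> complex \<Rightarrow> complex) set \<Rightarrow> ((complex \<times> complex \<Rightarrow> complex) \<Rightarrow> complex) \<Rightarrow>
     (complex \<Rightarrow> complex) \<Rightarrow> (complex \<Rightarrow> complex) \<Rightarrow> complex" where
  "sesq_form E u f g = pairing cstar2 E u (tensor_cnj f g)"

text \<open>The perturbed forms are only used for Laurent polynomials \<open>f\<close> and \<open>g\<close>, so that
  the derivatives are ordinary complex derivatives.\<close>

definition GU12_form ::
    "(complex \<times> complex \<Rightarrow> complex) set \<Rightarrow> ((complex \<times> complex \<Rightarrow> complex) \<Rightarrow> complex) \<Rightarrow>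
     laurent \<Rightarrow> laurent \<Rightarrow> nat \<Rightarrow> (nat \<Rightarrow> complex) \<Rightarrow> (nat \<Rightarrow> nat) \<Rightarrow>
     (nat \<Rightarrow> nat \<Rightarrow> (complex \<Rightarrow> complex) \<Rightarrow> complex) \<Rightarrow>
     (complex \<Rightarrow> complex) \<Rightarrow> (complex \<Rightarrow> complex) \<Rightarrow> complex" where
  "GU12_form E u L\<Gamma>1 LC2 d \<zeta> m \<xi> f g =
     pairing cstar2 E u
       (tensor_cnj (\<lambda>z. f z / laurent_eval L\<Gamma>1 z) (\<lambda>z. laurent_eval LC2 z * g z)) +
     (\<Sum>i=1..d. \<Sum>l<m i. 1 / fact l * (deriv ^^ l) f (\<zeta> i) *
        cnj (\<xi> i l (on_cstar (\<lambda>z. laurent_eval LC2 z * g z))))"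

definition GU21_form ::
    "(complex \<times> complex \<Rightarrow> complex) set \<Rightarrow> ((complex \<times> complex \<Rightarrow> complex) \<Rightarrow> complex) \<Rightarrow>
     laurent \<Rightarrow> laurent \<Rightarrow> nat \<Rightarrow> (nat \<Rightarrow> complex) \<Rightarrow> (nat \<Rightarrow> nat) \<Rightarrow>
     (nat \<Rightarrow> nat \<Rightarrow> (complex \<Rightarrow> complex) \<Rightarrow> complex) \<Rightarrow>
     (complex \<Rightarrow> complex) \<Rightarrow> (complex \<Rightarrow> complex) \<Rightarrow> complex" where
  "GU21_form E u LC1 L\<Gamma>2 d \<zeta> m \<xi> f g =
     pairing cstar2 E u
       (tensor_cnj (\<lambda>z. laurent_eval LC1 z * f z) (\<lambda>z. g z / laurent_eval L\<Gamma>2 z)) +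
     (\<Sum>i=1..d. \<Sum>l<m i. 1 / fact l * \<xi> i l (on_cstar (\<lambda>z. laurent_eval LC1 z * f z)) *
        cnj ((deriv ^^ l) g (\<zeta> i)))"


section \<open>Semi-infinite matrices\<close>

type_synonym cmatrix = "nat \<Rightarrow> nat \<Rightarrow> complex"
type_synonym cvector = "nat \<Rightarrow> complex"

text \<open>\<open>Sum_any\<close> is the sum over the support of the summand, which is finite whenever the left
  factor has finite rows.\<close>

definition mmul :: "cmatrix \<Rightarrow> cmatrix \<Rightarrow> cmatrix" (infixl \<open>\<odot>\<close> 70) where
  "(A \<odot> B) i j = Sum_any (\<lambda>k. A i k * B k j)"

definition mvec :: "cmatrix \<Rightarrow> cvector \<Rightarrow> cvector" (infixr \<open>\<bullet>v\<close> 69) where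
  "(A \<bullet>v x) i = Sum_any (\<lambda>k. A i k * x k)"

definition mone :: cmatrix where
  "mone i j = (if i = j then 1 else 0)"

definition mdiag :: "cvector \<Rightarrow> cmatrix" where
  "mdiag h i j = (if i = j then h i else 0)"

definition madj :: "cmatrix \<Rightarrow> cmatrix" where
  "madj A i j = cnj (A j i)"

definition row_finite :: "cmatrix \<Rightarrow> bool" where
  "row_finite A \<longleftrightarrow> (\<forall>i. finite {j. A i j \<noteq> 0})"

definition lower_unitriangular :: "cmatrix \<Rightarrow> bool" where
  "lower_unitriangular A \<longleftrightarrow> (\<forall>i. A i i = 1) \<and> (\<forall>i j. i < j \<longrightarrow> A i j = 0)"

text \<open>The two-sided inverse in the algebra of row-finite matrices, which contains all matrices
  inverted below.\<close>

definition minv :: "cmatrix \<Rightarrow> cmatrix" where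
  "minv A = (THE B. row_finite B \<and> A \<odot> B = mone \<and> B \<odot> A = mone)"

lemma mmul_expand:
  assumes "finite K" "{k. A i k \<noteq> 0} \<subseteq> K"
  shows "(A \<odot> B) i j = (\<Sum>k\<in>K. A i k * B k j)"
  unfolding mmul_def using assms by (intro Sum_any.expand_superset) auto

lemma row_finite_mmul:
  assumes "row_finite A" "row_finite B"
  shows "row_finite (A \<odot> B)"
  unfolding row_finite_def
proof
  fix i
  have "(A \<odot> B) i j = (\<Sum>k | A i k \<noteq> 0. A i k * B k j)" for j
    using assms by (intro mmul_expand) (auto simp: row_finite_def)
  then have "{j. (A \<odot> B) i j \<noteq> 0} \<subseteq> (\<Union>k\<in>{k. A i k \<noteq> 0}. {j. B k j \<noteq> 0})"
    by (auto elim!: sum.not_neutral_contains_not_neutral)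
  moreover have "finite (\<Union>k\<in>{k. A i k \<noteq> 0}. {j. B k j \<noteq> 0})"
    using assms by (auto simp: row_finite_def)
  ultimately show "finite {j. (A \<odot> B) i j \<noteq> 0}" by (rule finite_subset)
qed

lemma mmul_assoc:
  assumes A: "row_finite A" and B: "row_finite B"
  shows "(A \<odot> B) \<odot> C = A \<odot> (B \<odot> C)"
proof (intro ext)
  fix i j
  define K where "K = {k. A i k \<noteq> 0}"
  define M where "M = (\<Union>k\<in>K. {l. B k l \<noteq> 0})"
  have K: "finite K" using A by (auto simp: K_def row_finite_def)
  then have M: "finite M" using B by (auto simp: M_def row_finite_def)
  have AB: "(A \<odot> B) i l = (\<Sum>k\<in>K. A i k * B k l)" for l
    using K by (intro mmul_expand) (auto simp: K_def)
  then have "{l. (A \<odot> B) i l \<noteq> 0} \<subseteq> M"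
    by (auto simp: M_def elim!: sum.not_neutral_contains_not_neutral)
  with M have "((A \<odot> B) \<odot> C) i j = (\<Sum>l\<in>M. (\<Sum>k\<in>K. A i k * B k l) * C l j)"
    by (subst mmul_expand[of M]) (auto simp: AB)
  also have "\<dots> = (\<Sum>k\<in>K. A i k * (\<Sum>l\<in>M. B k l * C l j))"
    by (simp add: sum_distrib_left sum_distrib_right mult.assoc) (rule sum.swap)
  also have "\<dots> = (\<Sum>k\<in>K. A i k * (B \<odot> C) k j)"
  proof (intro sum.cong refl arg_cong[where f = "\<lambda>x. _ * x"])
    fix k assume "k \<in> K"
    then show "(\<Sum>l\<in>M. B k l * C l j) = (B \<odot> C) k j"
      using M by (intro mmul_expand[symmetric]) (auto simp: M_def)
  qed
  also have "\<dots> = (A \<odot> (B \<odot> C)) i j"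
    using K by (intro mmul_expand[symmetric]) (auto simp: K_def)
  finally show "((A \<odot> B) \<odot> C) i j = (A \<odot> (B \<odot> C)) i j" .
qed

lemma mmul_mone_left [simp]: "mone \<odot> A = A"
  by (intro ext, subst mmul_expand[where K = "{i}" for i]) (auto simp: mone_def)

lemma mmul_mone_right: "row_finite A \<Longrightarrow> A \<odot> mone = A"
  by (intro ext, subst mmul_expand[where K = "{k. A i k \<noteq> 0}" for i])
     (auto simp: mone_def row_finite_def if_distrib sum.delta cong: if_cong)

lemma minv_eqI:
  assumes A: "row_finite A" and B: "row_finite B" "A \<odot> B = mone" "B \<odot> A = mone"
  shows "minv A = B"
  unfolding minv_def
proof (rule the_equality)
  fix C assume C: "row_finite C \<and> A \<odot> C = mone \<and> C \<odot> A = mone"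
  have "C = C \<odot> (A \<odot> B)" using B C by (simp add: mmul_mone_right)
  also have "\<dots> = (C \<odot> A) \<odot> B" using A C by (intro mmul_assoc[symmetric]) auto
  also have "\<dots> = B" using C by simp
  finally show "C = B" .
qed (use B in blast)

lemma row_finite_lower_unitriangular: "lower_unitriangular A \<Longrightarrow> row_finite A"
  unfolding row_finite_def lower_unitriangular_def
  by (metis (mono_tags, lifting) finite_nat_set_iff_bounded_le mem_Collect_eq not_le)

lemma lower_unitriangular_right_inverse:
  assumes A: "lower_unitriangular A"
  obtains B where "lower_unitriangular B" "A \<odot> B = mone"
proof -
  define B where "B = (\<lambda>i. wfrec less_than
    (\<lambda>R i j. (if i = j then 1 else 0) - (\<Sum>k<i. A i k * R k j)) i)"
  have B: "B i j = (if i = j then 1 else 0) - (\<Sum>k<i. A i k * B k j)" for i j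
    unfolding B_def by (subst wfrec) (auto simp: cut_def intro!: sum.cong)
  have z: "i < j \<Longrightarrow> B i j = 0" for i j
    by (induction i rule: less_induct) (subst B, auto intro!: sum.neutral)
  have "B i i = 1" for i
    by (subst B) (auto intro!: sum.neutral simp: z)
  with z have "lower_unitriangular B" by (simp add: lower_unitriangular_def)
  moreover have "A \<odot> B = mone"
  proof (intro ext)
    fix i j
    have "(A \<odot> B) i j = (\<Sum>k\<in>{..i}. A i k * B k j)"
      using A by (intro mmul_expand) (auto simp: lower_unitriangular_def not_less[symmetric])
    also have "\<dots> = (\<Sum>k<i. A i k * B k j) + B i j"
      using A by (simp add: lower_unitriangular_def flip: lessThan_Suc_atMost)
    also have "\<dots> = mone i j" by (subst (2) B) (simp add: mone_def)
    finally show "(A \<odot> B) i j = mone i j" .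
  qed
  ultimately show ?thesis by (rule that)
qed

lemma minv_lower_unitriangular:
  assumes A: "lower_unitriangular A"
  shows "lower_unitriangular (minv A)" "A \<odot> minv A = mone" "minv A \<odot> A = mone"
proof -
  obtain B where B: "lower_unitriangular B" "A \<odot> B = mone"
    using lower_unitriangular_right_inverse[OF A] .
  obtain C where C: "lower_unitriangular C" "B \<odot> C = mone"
    using lower_unitriangular_right_inverse[OF B(1)] .
  note rf = row_finite_lower_unitriangular
  have "A = (A \<odot> B) \<odot> C"
    using A B(1) C by (simp add: mmul_assoc mmul_mone_right rf)
  then have "B \<odot> A = mone" using B C by simp
  with B A have "minv A = B" by (intro minv_eqI) (auto simp: rf)
  with B \<open>B \<odot> A = mone\<close>
  show "lower_unitriangular (minv A)" "A \<odot> minv A = mone" "minv A \<odot> A = mone" by auto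
qed

primrec mpow :: "cmatrix \<Rightarrow> nat \<Rightarrow> cmatrix" where
  "mpow A 0 = mone"
| "mpow A (Suc n) = A \<odot> mpow A n"

definition mpowi :: "cmatrix \<Rightarrow> int \<Rightarrow> cmatrix" where
  "mpowi A k = (if 0 \<le> k then mpow A (nat k) else mpow (minv A) (nat (- k)))"

definition laurent_mat :: "laurent \<Rightarrow> cmatrix \<Rightarrow> cmatrix" where
  "laurent_mat p A i j =
     (\<Sum>k\<in>Poly_Mapping.keys p. Poly_Mapping.lookup p k * mpowi A k i j)"

definition quasidefinite :: "cmatrix \<Rightarrow> bool" where
  "quasidefinite G \<longleftrightarrow> (\<forall>n. Determinant.det (Matrix.mat n n (\<lambda>(i, j). G i j)) \<noteq> 0)"

definition gauss_borel :: "cmatrix \<Rightarrow> cmatrix \<Rightarrow> cvector \<Rightarrow> cmatrix \<Rightarrow> bool" where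
  "gauss_borel G S1 h S2 \<longleftrightarrow>
     lower_unitriangular S1 \<and> lower_unitriangular S2 \<and> (\<forall>n. h n \<noteq> 0) \<and>
     G = minv S1 \<odot> mdiag h \<odot> madj (minv S2)"


section \<open>The CMV basis\<close>

definition cmv :: "nat \<Rightarrow> complex \<Rightarrow> complex" where
  "cmv n z = (if even n then z powi int (n div 2) else z powi (- int (n div 2) - 1))"

definition cmv_vec :: "complex \<Rightarrow> cvector" where
  "cmv_vec z n = cmv n z"

definition upsilon :: cmatrix where
  "upsilon i j =
     (if even i \<and> j = i + 2 \<or> i = 1 \<and> j = 0 \<or> odd i \<and> i = j + 2 then 1 else 0)"

lemma upsilon_row:
  "upsilon n k = (if k = (if even n then n + 2 else if n = 1 then 0 else n - 2) then 1 else 0)"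
proof -
  have "(even n \<and> k = n + 2 \<or> n = 1 \<and> k = 0 \<or> odd n \<and> n = k + 2) \<longleftrightarrow>
      k = (if even n then n + 2 else if n = 1 then 0 else n - 2)"
  proof (cases "even n")
    case False
    then obtain l where "n = 2 * l + 1" by (elim oddE)
    then show ?thesis by (cases l) auto
  qed auto
  then show ?thesis unfolding upsilon_def by (simp only:)
qed

lemma upsilon_cmv: "z \<noteq> 0 \<Longrightarrow> upsilon \<bullet>v cmv_vec z = (\<lambda>n. z * cmv_vec z n)"
proof
  fix n :: nat assume z: "z \<noteq> 0"
  define s where "s = (if even n then n + 2 else if n = 1 then 0 else n - 2)"
  have s: "upsilon n k = (if k = s then 1 else 0)" for k
    unfolding s_def by (rule upsilon_row)
  have "(upsilon \<bullet>v cmv_vec z) n = (\<Sum>k\<in>{s}. upsilon n k * cmv_vec z k)"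
    unfolding mvec_def by (intro Sum_any.expand_superset) (auto simp: s)
  also have "\<dots> = cmv s z" by (simp add: s cmv_vec_def)
  also have "\<dots> = z * cmv n z"
  proof (cases "even n")
    case True
    then show ?thesis using z
      by (auto simp: s_def cmv_def power_int_add elim!: evenE)
  next
    case False
    then obtain k where k: "n = 2 * k + 1" by (elim oddE)
    show ?thesis
    proof (cases k)
      case 0
      then show ?thesis using z k by (simp add: s_def cmv_def)
    next
      case (Suc l)
      have "- int l - 1 = (- int l - 2) + 1" by simp
      then have "z powi (- int l - 1) = z * z powi (- int l - 2)"
        using z power_int_add_1'[of z "- int l - 2"] by metis
      moreover have "z powi (- 2 - int l) = z powi (- int l - 2)"
        by (rule arg_cong[where f = "\<lambda>n. z powi n"]) simp
      ultimately show ?thesis using z k Suc by (simp add: s_def cmv_def)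
    qed
  qed
  finally show "(upsilon \<bullet>v cmv_vec z) n = z * cmv_vec z n" by (simp add: cmv_vec_def)
qed

lemma minv_upsilon: "minv upsilon = (\<lambda>i j. upsilon j i)"
proof (rule minv_eqI)
  define s where "s n = (if even n then n + 2 else if n = 1 then 0 else n - 2)" for n :: nat
  define t where "t n = (if n = 0 then 1 else if even n then n - 2 else n + 2)" for n :: nat
  have s: "upsilon n k = (if k = s n then 1 else 0)" for n k
    unfolding s_def by (rule upsilon_row)
  have st: "s (t n) = n" "t (s n) = n" for n
    unfolding s_def t_def by presburger+
  have inj: "s i = s j \<longleftrightarrow> i = j" "t i = t j \<longleftrightarrow> i = j" for i j
    by (metis st(2), metis st(1))
  have "k = t n \<longleftrightarrow> n = s k" for n k using st by metis
  then have t: "upsilon k n = (if k = t n then 1 else 0)" for n k by (simp add: s)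
  show "row_finite upsilon" by (simp add: row_finite_def s)
  show "row_finite (\<lambda>i j. upsilon j i)" by (simp add: row_finite_def t)
  show "upsilon \<odot> (\<lambda>i j. upsilon j i) = mone"
  proof (intro ext)
    fix i j
    have "(upsilon \<odot> (\<lambda>i j. upsilon j i)) i j = (\<Sum>k\<in>{s i}. upsilon i k * upsilon j k)"
      by (rule mmul_expand) (auto simp: s)
    also have "\<dots> = mone i j" by (simp add: s mone_def inj)
    finally show "(upsilon \<odot> (\<lambda>i j. upsilon j i)) i j = mone i j" .
  qed
  show "(\<lambda>i j. upsilon j i) \<odot> upsilon = mone"
  proof (intro ext)
    fix i j
    have "((\<lambda>i j. upsilon j i) \<odot> upsilon) i j = (\<Sum>k\<in>{t i}. upsilon k i * upsilon k j)"
      by (rule mmul_expand) (auto simp: t)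
    also have "\<dots> = mone i j" by (simp add: t mone_def inj)
    finally show "((\<lambda>i j. upsilon j i) \<odot> upsilon) i j = mone i j" .
  qed
qed

definition cmv_gram ::
    "((complex \<Rightarrow> complex) \<Rightarrow> (complex \<Rightarrow> complex) \<Rightarrow> complex) \<Rightarrow> cmatrix" where
  "cmv_gram B k l = B (cmv k) (cmv l)"

end

theory Submission
  imports Defs
begin

text \<open>The vector \<open>\<chi>(z)\<close> is an eigenvector of \<open>\<Upsilon>\<close> with eigenvalue \<open>z\<close>, hence of \<open>L(\<Upsilon>)\<close> with
  eigenvalue \<open>L(z)\<close>. A connector \<open>A L(\<Upsilon>) B\<^sup>-\<^sup>1\<close> therefore maps \<open>B \<chi>(z)\<close> to \<open>L(z) A \<chi>(z)\<close>.\<close>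

text \<open>A vector is encoded as the matrix all of whose columns equal \<open>x\<close>, so that
  facts about \<open>mmul\<close> carry over to \<open>mvec\<close>. Column 0 is read off, but the
  columns of the product all agree.\<close>

lemma mvec_eq_mmul: "A \<bullet>v x = (\<lambda>i. (A \<odot> (\<lambda>k j. x k)) i 0)"
  by (simp add: mvec_def mmul_def fun_eq_iff)

lemma mvec_expand:
  assumes "finite K" "{k. A i k \<noteq> 0} \<subseteq> K"
  shows "(A \<bullet>v x) i = (\<Sum>k\<in>K. A i k * x k)"
  unfolding mvec_eq_mmul using assms by (rule mmul_expand)

text \<open>This is associativity of the matrix product, applied to the matrix whose columns all
  equal \<open>x\<close>.\<close>

lemma mvec_mmul:
  assumes "row_finite A" "row_finite B"
  shows "(A \<odot> B) \<bullet>v x = A \<bullet>v (B \<bullet>v x)"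
proof -
  have "(A \<odot> B) \<odot> (\<lambda>k j. x k) = A \<odot> (B \<odot> (\<lambda>k j. x k))"
    by (rule mmul_assoc[OF assms])
  then show ?thesis
    unfolding mvec_def mmul_def fun_eq_iff by simp
qed

lemma mvec_mone: "mone \<bullet>v x = x"
proof
  fix i show "(mone \<bullet>v x) i = x i"
    by (subst mvec_expand[where K = "{i}"]) (auto simp: mone_def)
qed

lemma mvec_scale:
  assumes "row_finite A"
  shows "A \<bullet>v (\<lambda>n. c * x n) = (\<lambda>n. c * (A \<bullet>v x) n)"
proof
  fix i
  have "finite {k. A i k \<noteq> 0}" using assms by (simp add: row_finite_def)
  then have "(A \<bullet>v y) i = (\<Sum>k | A i k \<noteq> 0. A i k * y k)" for y
    by (rule mvec_expand) simp
  then show "(A \<bullet>v (\<lambda>n. c * x n)) i = c * (A \<bullet>v x) i"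
    by (simp add: sum_distrib_left mult.left_commute)
qed

lemma row_finite_mone: "row_finite mone"
  by (simp add: row_finite_def mone_def)

lemma row_finite_mpow: "row_finite A \<Longrightarrow> row_finite (mpow A n)"
  by (induction n) (auto intro: row_finite_mone row_finite_mmul)

lemma row_finite_mpowi:
  "row_finite A \<Longrightarrow> row_finite (minv A) \<Longrightarrow> row_finite (mpowi A k)"
  by (simp add: mpowi_def row_finite_mpow)

text \<open>Finitely many powers occur in \<open>p\<close>, so row \<open>i\<close> is supported on
  a finite union of finite row supports.\<close>

lemma row_finite_laurent_mat:
  assumes "row_finite A" "row_finite (minv A)"
  shows "row_finite (laurent_mat p A)"
  unfolding row_finite_def
proof
  fix i
  have "{j. laurent_mat p A i j \<noteq> 0} \<subseteq> (\<Union>k\<in>Poly_Mapping.keys p. {j. mpowi A k i j \<noteq> 0})"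
    unfolding laurent_mat_def by (auto elim!: sum.not_neutral_contains_not_neutral)
  moreover have "finite (\<Union>k\<in>Poly_Mapping.keys p. {j. mpowi A k i j \<noteq> 0})"
    using row_finite_mpowi[OF assms] by (auto simp: row_finite_def)
  ultimately show "finite {j. laurent_mat p A i j \<noteq> 0}"
    by (rule finite_subset)
qed

lemma mpow_eigenvector:
  assumes "row_finite A" "A \<bullet>v x = (\<lambda>n. c * x n)"
  shows "mpow A k \<bullet>v x = (\<lambda>n. c ^ k * x n)"
proof (induction k)
  case (Suc k)
  then show ?case using assms
    by (simp add: mvec_mmul row_finite_mpow mvec_scale mult.left_commute mult.assoc)
qed (simp add: mvec_mone)

text \<open>Negative powers reduce to positive powers of \<open>minv A\<close>, for which
  \<open>x\<close> is an eigenvector with eigenvalue \<open>inverse c\<close>: apply the left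
  inverse to \<open>A \<bullet>v x\<close> and divide by \<open>c\<close>.\<close>

lemma mpowi_eigenvector:
  assumes A: "row_finite A" "row_finite (minv A)" "minv A \<odot> A = mone"
    and x: "A \<bullet>v x = (\<lambda>n. c * x n)" and c: "c \<noteq> 0"
  shows "mpowi A k \<bullet>v x = (\<lambda>n. c powi k * x n)"
proof -
  have "x = minv A \<bullet>v (A \<bullet>v x)"
    by (simp add: A mvec_mone flip: mvec_mmul)
  then have "x = (\<lambda>n. c * (minv A \<bullet>v x) n)"
    by (simp add: x mvec_scale A(2))
  then have "\<And>n. x n = c * (minv A \<bullet>v x) n" by metis
  then have "minv A \<bullet>v x = (\<lambda>n. inverse c * x n)"
    using c by (simp add: field_simps fun_eq_iff)
  \<comment> \<open>\<open>mpowi\<close> and \<open>powi\<close> split at the same place: exponents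
    from 0 on use \<open>A\<close> and \<open>c\<close>, negative ones use \<open>minv A\<close> and
    \<open>inverse c\<close>.\<close>
  then show ?thesis
    using x A by (simp add: mpowi_def mpow_eigenvector power_int_def)
qed

lemma laurent_mat_eigenvector:
  assumes A: "row_finite A" "row_finite (minv A)" "minv A \<odot> A = mone"
    and x: "A \<bullet>v x = (\<lambda>n. c * x n)" and c: "c \<noteq> 0"
  shows "laurent_mat p A \<bullet>v x = (\<lambda>n. laurent_eval p c * x n)"
proof
  fix i
  \<comment> \<open>A single finite index set that contains the support of row \<open>i\<close> for
    every power in \<open>p\<close>, hence also for \<open>laurent_mat p A\<close>. With all sums
    taken over it, the sums over powers and over columns can be interchanged.\<close>
  let ?S = "\<Union>k\<in>Poly_Mapping.keys p. {j. mpowi A k i j \<noteq> 0}"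
  have fin: "finite ?S"
    using row_finite_mpowi[OF A(1,2)] by (auto simp: row_finite_def)
  have "{j. laurent_mat p A i j \<noteq> 0} \<subseteq> ?S"
    unfolding laurent_mat_def by (auto elim!: sum.not_neutral_contains_not_neutral)
  then have "(laurent_mat p A \<bullet>v x) i = (\<Sum>j\<in>?S. laurent_mat p A i j * x j)"
    by (rule mvec_expand[OF fin])
  also have "\<dots> = (\<Sum>k\<in>Poly_Mapping.keys p. Poly_Mapping.lookup p k *
      (\<Sum>j\<in>?S. mpowi A k i j * x j))"
    unfolding laurent_mat_def sum_distrib_right sum_distrib_left
    by (subst sum.swap) (simp add: mult.assoc)
  also have "\<dots> = (\<Sum>k\<in>Poly_Mapping.keys p. Poly_Mapping.lookup p k * (mpowi A k \<bullet>v x) i)"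
    by (intro sum.cong refl arg_cong2[where f = "(*)"] mvec_expand[OF fin, symmetric]) auto
  also have "\<dots> = laurent_eval p c * x i"
    by (simp add: mpowi_eigenvector[OF assms] laurent_eval_def sum_distrib_right mult.assoc)
  finally show "(laurent_mat p A \<bullet>v x) i = laurent_eval p c * x i" .
qed

text \<open>The matrix is a permutation matrix, so its transpose inverts it. These are the three
  facts that the eigenvector lemmas ask of \<open>A\<close>.\<close>

lemma upsilon_inverse:
  "row_finite upsilon" "row_finite (minv upsilon)" "minv upsilon \<odot> upsilon = mone"
proof -
  \<comment> \<open>\<open>t n\<close> is the row that holds the single 1 of column
    \<open>n\<close>. On the CMV basis the map \<open>t\<close> is multiplication by the inverse of
    \<open>z\<close>.\<close>
  define t where "t n = (if n = 0 then 1 else if even n then n - 2 else n + 2)" for n :: nat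
  have t: "upsilon k n = (if k = t n then 1 else 0)" for k n
    unfolding upsilon_row t_def by (rule if_cong; presburger)
  have inj: "t i = t j \<longleftrightarrow> i = j" for i j
    unfolding t_def by presburger
  show "row_finite upsilon" by (simp add: row_finite_def upsilon_row)
  show "row_finite (minv upsilon)" by (simp add: row_finite_def minv_upsilon t)
  show "minv upsilon \<odot> upsilon = mone"
  proof (intro ext)
    fix i j
    have "(minv upsilon \<odot> upsilon) i j = (\<Sum>k\<in>{t i}. minv upsilon i k * upsilon k j)"
      by (rule mmul_expand) (auto simp: t minv_upsilon)
    \<comment> \<open>The remaining term is 1 if \<open>t i = t j\<close> and 0 otherwise, and
      \<open>t\<close> is injective.\<close>
    then show "(minv upsilon \<odot> upsilon) i j = mone i j"
      by (simp add: t minv_upsilon mone_def inj)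
  qed
qed

text \<open>The common form of the four connectors. Row finiteness of all factors allows them to act
  on the vector one after another, from right to left.\<close>

lemma connector_cmv_vec:
  assumes "row_finite A" "lower_unitriangular B" "z \<noteq> 0"
  shows "(A \<odot> laurent_mat p upsilon \<odot> minv B) \<bullet>v (B \<bullet>v cmv_vec z) =
    (\<lambda>n. laurent_eval p z * (A \<bullet>v cmv_vec z) n)"
proof -
  note B = minv_lower_unitriangular[OF assms(2)]
  note rf = assms(1) row_finite_lower_unitriangular[OF assms(2)]
    row_finite_lower_unitriangular[OF B(1)] row_finite_laurent_mat[OF upsilon_inverse(1,2)]
  have "minv B \<bullet>v (B \<bullet>v cmv_vec z) = cmv_vec z"
    by (simp add: rf B(3) mvec_mone flip: mvec_mmul)
  moreover have "laurent_mat p upsilon \<bullet>v cmv_vec z = (\<lambda>n. laurent_eval p z * cmv_vec z n)"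
    using assms(3) by (intro laurent_mat_eigenvector upsilon_inverse upsilon_cmv)
  ultimately show ?thesis
    by (simp add: rf mvec_mmul row_finite_mmul mvec_scale)
qed

theorem proposition8:
  fixes F :: "(complex \<Rightarrow> complex) set"
    and T :: "(complex \<Rightarrow> complex) topology"
    and E :: "(complex \<times> complex \<Rightarrow> complex) set"
    and u :: "(complex \<times> complex \<Rightarrow> complex) \<Rightarrow> complex"
    and L\<Gamma>1 L\<Gamma>2 LC1 LC2 :: laurent
    and N\<Gamma>p N\<Gamma>m NCp NCm d1 d2 :: nat
    and \<zeta>1 \<zeta>2 :: "nat \<Rightarrow> complex"
    and m1 m2 :: "nat \<Rightarrow> nat"
    and \<xi>1 \<xi>2 :: "nat \<Rightarrow> nat \<Rightarrow> (complex \<Rightarrow> complex) \<Rightarrow> complex"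
    and S1 S2 S12_1 S12_2 S21_1 S21_2 :: cmatrix
    and H H12 H21 :: cvector
    and z :: complex
  defines "G \<equiv> cmv_gram (sesq_form E u)"
    and "G12 \<equiv> cmv_gram (GU12_form E u L\<Gamma>1 LC2 d1 \<zeta>1 m1 \<xi>1)"
    and "G21 \<equiv> cmv_gram (GU21_form E u LC1 L\<Gamma>2 d2 \<zeta>2 m2 \<xi>2)"
    and "\<phi>1 \<equiv> S1 \<bullet>v cmv_vec z"
    and "\<phi>2 \<equiv> S2 \<bullet>v cmv_vec z"
    and "\<phi>12_1 \<equiv> S12_1 \<bullet>v cmv_vec z"
    and "\<phi>12_2 \<equiv> S12_2 \<bullet>v cmv_vec z"
    and "\<phi>21_1 \<equiv> S21_1 \<bullet>v cmv_vec z"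
    and "\<phi>21_2 \<equiv> S21_2 \<bullet>v cmv_vec z"
    and "\<Omega>12_1 \<equiv> S1 \<odot> laurent_mat L\<Gamma>1 upsilon \<odot> minv S12_1"
    and "\<Omega>12_2 \<equiv> S12_2 \<odot> laurent_mat LC2 upsilon \<odot> minv S2"
    and "\<Omega>21_1 \<equiv> S21_1 \<odot> laurent_mat LC1 upsilon \<odot> minv S1"
    and "\<Omega>21_2 \<equiv> S2 \<odot> laurent_mat L\<Gamma>2 upsilon \<odot> minv S21_2"
  assumes "fundamental_space F T"
    and "bivariate_functional F E u"
    and "laurent_bidegree L\<Gamma>1 N\<Gamma>p N\<Gamma>m" and "laurent_bidegree L\<Gamma>2 N\<Gamma>p N\<Gamma>m"
    and "laurent_bidegree LC1 NCp NCm" and "laurent_bidegree LC2 NCp NCm"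
    and "laurent_zeros L\<Gamma>1 \<inter> supp1 E u = {}"
    and "laurent_zeros L\<Gamma>2 \<inter> supp2 E u = {}"
    and "zeros_with_mult L\<Gamma>1 d1 \<zeta>1 m1"
    and "zeros_with_mult L\<Gamma>2 d2 \<zeta>2 m2"
    and "\<forall>i\<in>{1..d1}. \<forall>l<m1 i. linear_functional F (\<xi>1 i l)"
    and "\<forall>i\<in>{1..d2}. \<forall>l<m2 i. linear_functional F (\<xi>2 i l)"
    and "quasidefinite G" and "gauss_borel G S1 H S2"
    and "quasidefinite G12" and "gauss_borel G12 S12_1 H12 S12_2"
    and "quasidefinite G21" and "gauss_borel G21 S21_1 H21 S21_2"
    and "z \<in> cstar"
  shows "\<Omega>12_1 \<bullet>v \<phi>12_1 = (\<lambda>n. laurent_eval L\<Gamma>1 z * \<phi>1 n)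
    \<and> \<Omega>12_2 \<bullet>v \<phi>2 = (\<lambda>n. laurent_eval LC2 z * \<phi>12_2 n)
    \<and> \<Omega>21_1 \<bullet>v \<phi>1 = (\<lambda>n. laurent_eval LC1 z * \<phi>21_1 n)
    \<and> \<Omega>21_2 \<bullet>v \<phi>21_2 = (\<lambda>n. laurent_eval L\<Gamma>2 z * \<phi>2 n)"
proof -
  \<comment> \<open>Unitriangularity of the Gauss-Borel factors makes each of them row finite and
    makes \<open>minv\<close> a genuine inverse.\<close>
  have "lower_unitriangular S1" "lower_unitriangular S2"
    "lower_unitriangular S12_1" "lower_unitriangular S12_2"
    "lower_unitriangular S21_1" "lower_unitriangular S21_2"
    using \<open>gauss_borel G S1 H S2\<close> \<open>gauss_borel G12 S12_1 H12 S12_2\<close>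
      \<open>gauss_borel G21 S21_1 H21 S21_2\<close>
    by (simp_all add: gauss_borel_def)
  moreover have "z \<noteq> 0" using \<open>z \<in> cstar\<close> by (simp add: cstar_def)
  \<comment> \<open>The four identities are \<open>connector_cmv_vec\<close> with
    \<open>(A, B)\<close> equal to \<open>(S1, S12_1)\<close>, \<open>(S12_2, S2)\<close>,
    \<open>(S21_1, S1)\<close> and \<open>(S2, S21_2)\<close>.\<close>
  ultimately show ?thesis
    unfolding \<Omega>12_1_def \<Omega>12_2_def \<Omega>21_1_def \<Omega>21_2_def \<phi>1_def \<phi>2_def
      \<phi>12_1_def \<phi>12_2_def \<phi>21_1_def \<phi>21_2_def
    by (intro conjI connector_cmv_vec row_finite_lower_unitriangular)
qed

end
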